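(* Let $q$ be a prime power, let $V$ and $W$ be vector spaces over $\mathbb{F}_q$ of dimensions $m$ and $n$, respectively, and let $\ell\ge 0$ be an integer. Let $\mathcal{N}(m,n;\ell)$ be the set of triples $(f,g,v)$ where $(f,g)$ is a nilpotent pair of linear maps $f:V\to W$, $g:W\to V$, and $v\in V$ is a balanced vector of length $\ell$ for $(f,g)$. Then $$|\mathcal{N}(m,n;\ell)| = \prod_{i=0}^{\ell-1}(q^m-q^i)\,\prod_{j=0}^{\ell-1}(q^n-q^j)\; q^{\ell(m-\ell)}\,q^{\ell(n-\ell)}\; q^{2(m-\ell)(n-\ell)-(m-\ell)-(n-\ell)}\left(q^{m-\ell}+q^{n-\ell}-1\right).$$
   Context: Let $f:V\to W$ and $g:W\to V$ be linear maps and put $T=gf\in\mathrm{End}(V)$, $T'=fg\in\mathrm{End}(W)$. The pair $(f,g)$ is a nilpotent pair if $T$ is nilpotent (equivalently, $T'$ is nilpotent). For a nilpotent pair and $v\in V$, let $T[v]\subseteq V$ be the span of $v,Tv,T^2v,\dots$ and $T'[fv]\subseteq W$ the span of $fv,T'(fv),(T')^2(fv),\dots$. The vector $v$ is balanced if $\dim T[v]=\dim T'[fv]$, and its length is then this common dimension; in particular, $v=0$ is balanced of length $0$. Empty products equal $1$, and powers of $q$ are interpreted as rational numbers (exponents may be negative). *)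

theory Defs
  imports "HOL-Number_Theory.Prime_Powers" "HOL-Library.Cardinality"
begin

text \<open>
  Vector spaces are given by a scalar multiplication on a whole type, as in the locale
  \<^locale>\<open>vector_space\<close>. In this way dimension 0 is not excluded.
\<close>

definition nilpotent_map :: "('v::zero \<Rightarrow> 'v) \<Rightarrow> bool" where
  "nilpotent_map T \<longleftrightarrow> (\<exists>k::nat. \<forall>x. (T ^^ k) x = 0)"

definition nilpotent_pair ::
  "('k::field \<Rightarrow> 'v::ab_group_add \<Rightarrow> 'v) \<Rightarrow> ('k \<Rightarrow> 'w::ab_group_add \<Rightarrow> 'w) \<Rightarrow>
   ('v \<Rightarrow> 'w) \<Rightarrow> ('w \<Rightarrow> 'v) \<Rightarrow> bool" where
  "nilpotent_pair sV sW f g \<longleftrightarrow>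
     Vector_Spaces.linear sV sW f \<and> Vector_Spaces.linear sW sV g \<and> nilpotent_map (g \<circ> f)"

definition cyclic_span ::
  "('k::field \<Rightarrow> 'v::ab_group_add \<Rightarrow> 'v) \<Rightarrow> ('v \<Rightarrow> 'v) \<Rightarrow> 'v \<Rightarrow> 'v set" where
  "cyclic_span s T v = module.span s (range (\<lambda>i::nat. (T ^^ i) v))"

definition balanced ::
  "('k::field \<Rightarrow> 'v::ab_group_add \<Rightarrow> 'v) \<Rightarrow> ('k \<Rightarrow> 'w::ab_group_add \<Rightarrow> 'w) \<Rightarrow>
   ('v \<Rightarrow> 'w) \<Rightarrow> ('w \<Rightarrow> 'v) \<Rightarrow> 'v \<Rightarrow> bool" where
  "balanced sV sW f g v \<longleftrightarrow>
     vector_space.dim sV (cyclic_span sV (g \<circ> f) v) =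
     vector_space.dim sW (cyclic_span sW (f \<circ> g) (f v))"

text \<open>The length of \<open>v\<close>; meaningful only when \<open>v\<close> is balanced.\<close>

definition balanced_length ::
  "('k::field \<Rightarrow> 'v::ab_group_add \<Rightarrow> 'v) \<Rightarrow> ('v \<Rightarrow> 'w) \<Rightarrow> ('w \<Rightarrow> 'v) \<Rightarrow> 'v \<Rightarrow> nat" where
  "balanced_length sV f g v = vector_space.dim sV (cyclic_span sV (g \<circ> f) v)"

definition balanced_triples ::
  "('k::field \<Rightarrow> 'v::ab_group_add \<Rightarrow> 'v) \<Rightarrow> ('k \<Rightarrow> 'w::ab_group_add \<Rightarrow> 'w) \<Rightarrow> nat \<Rightarrow>
   (('v \<Rightarrow> 'w) \<times> ('w \<Rightarrow> 'v) \<times> 'v) set" where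
  "balanced_triples sV sW l =
     {(f, g, v). nilpotent_pair sV sW f g \<and> balanced sV sW f g v \<and> balanced_length sV f g v = l}"

end

theory Submission
  imports Defs
begin

text \<open>
  Let \<open>(f, g, v)\<close> be a triple as in the theorem and \<open>T = g \<circ> f\<close>. Nilpotency forces the first
  dependence in the orbit \<open>v, T v, T\<^sup>2 v, \<dots>\<close> to be a zero
  (\<open>nilpotent_orbit_dependent\<close>), and the same holds for the orbit of \<open>f v\<close> under \<open>f \<circ> g\<close>. So
  \<open>v\<close> is balanced of length \<open>l\<close> exactly if \<open>T\<^sup>l v = 0\<close> and the two lists
  \<open>v\<^sub>i = T\<^sup>i v\<close> and \<open>w\<^sub>i = f v\<^sub>i\<close>, for \<open>i < l\<close>, are both linearly independent. The triples are
  therefore partitioned by pairs of independent lists of length \<open>l\<close>; these account for the two products, and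
  what remains is the number of nilpotent pairs \<open>(f, g)\<close> with the prescribed values
  \<open>f v\<^sub>i = w\<^sub>i\<close>, \<open>g w\<^sub>i = v\<^bsub>i+1\<^esub>\<close> (where \<open>v\<^sub>l\<close> means \<open>0\<close>).

  The main step fixes \<open>f\<close> and counts \<open>g\<close>. Let \<open>g\<close> be prescribed on an independent set \<open>Y\<close> so
  that \<open>f \<circ> g\<close> preserves \<open>B = span Y\<close> and is nilpotent there. Among all linear \<open>g\<close> with these
  values, the proportion of those with \<open>f \<circ> g\<close> nilpotent is exactly \<open>\<bar>f\<^sup>-\<^sup>1(B)\<bar> / \<bar>V\<bar>\<close>
  (\<open>card_nilpotent_extensions\<close>). To see this, choose a vector \<open>w\<close> outside \<open>B\<close> and reveal the
  values of \<open>g\<close> along the orbit of \<open>w\<close> one at a time. As long as the orbit stays independent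
  modulo \<open>B\<close>, the proportion does not change (\<open>card_nilpotent_extensions_orbit\<close>): a new value
  either brings the orbit back into \<open>B\<close>, so that \<open>B\<close> may be replaced by the larger space
  spanned with the orbit, or makes nilpotency impossible, or prolongs the orbit.
  Prescribed values on subspaces take the place of quotient spaces here.

  It remains to sum \<open>\<bar>f\<^sup>-\<^sup>1(B)\<bar>\<close> over \<open>f\<close>. This is the number of pairs \<open>(f, v)\<close> with
  \<open>f v \<in> B\<close>, and for fixed \<open>v\<close> such \<open>f\<close> are easy to count: the condition is automatic if
  \<open>v\<close> lies in the span of the \<open>v\<^sub>i\<close>, and otherwise \<open>f v\<close> is a free choice in \<open>B\<close>
  (\<open>sum_card_preimages\<close>). Up to a common power of \<open>q\<close>, the two kinds of \<open>v\<close>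
  contribute \<open>q\<^bsup>n-l\<^esup>\<close> and \<open>q\<^bsup>m-l\<^esup> - 1\<close>.
\<close>

section \<open>Counting in finite vector spaces\<close>

context vector_space
begin

lemma span_insert_eq_image: "span (insert b B) = (\<lambda>(c, x). scale c b + x) ` (UNIV \<times> span B)"
proof (intro set_eqI iffI)
  fix y assume "y \<in> span (insert b B)"
  then obtain c where "y - scale c b \<in> span B" by (auto simp: span_breakdown_eq)
  then show "y \<in> (\<lambda>(c, x). scale c b + x) ` (UNIV \<times> span B)"
    by (intro image_eqI[of _ _ "(c, y - scale c b)"]) auto
next
  fix y assume "y \<in> (\<lambda>(c, x). scale c b + x) ` (UNIV \<times> span B)"
  then obtain c x where "x \<in> span B" "y = scale c b + x" by auto
  then show "y \<in> span (insert b B)"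
    by (auto simp: span_breakdown_eq intro!: exI[of _ c])
qed

end

locale finite_vector_space = vector_space scale
  for scale :: "'k::{field,finite} \<Rightarrow> 'v::ab_group_add \<Rightarrow> 'v" +
  assumes finite_UNIV: "finite (UNIV :: 'v set)"
begin

lemma finite_set [simp, intro]: "finite (A :: 'v set)"
  by (rule finite_subset[OF subset_UNIV finite_UNIV])

lemma card_span:
  assumes "independent B"
  shows "card (span B) = CARD('k) ^ card B"
proof -
  have "finite B" by simp
  then show ?thesis using assms
  proof (induction B rule: finite_induct)
    case empty
    then show ?case by simp
  next
    case (insert b B)
    have b: "b \<notin> span B" and B: "independent B"
      using insert.prems insert.hyps by (auto simp: independent_insert)
    let ?h = "\<lambda>(c, x). scale c b + x"
    have inj: "inj_on ?h (UNIV \<times> span B)"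
    proof (intro inj_onI, clarify)
      fix c x c' x'
      assume x: "x \<in> span B" "x' \<in> span B" and eq: "scale c b + x = scale c' b + x'"
      from eq have "scale (c - c') b = x' - x"
        by (simp add: scale_left_diff_distrib algebra_simps)
      then have sp: "scale (c - c') b \<in> span B" using x by (simp add: span_diff)
      have "c = c'"
      proof (rule ccontr)
        assume "c \<noteq> c'"
        with span_scale[OF sp, of "inverse (c - c')"] have "b \<in> span B" by simp
        with b show False by simp
      qed
      with eq show "c = c' \<and> x = x'" by simp
    qed
    then have "card (span (insert b B)) = card ((UNIV :: 'k set) \<times> span B)"
      unfolding span_insert_eq_image by (rule card_image)
    then show ?case using insert.IH[OF B] insert.hyps by (simp add: card_cartesian_product)
  qed
qed

lemma card_space: "CARD('v) = CARD('k) ^ dim (UNIV :: 'v set)"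
proof -
  obtain B where "independent B" "span B = UNIV" "card B = dim (UNIV :: 'v set)"
    using basis_exists[of UNIV] by (metis top.extremum_uniqueI)
  then show ?thesis using card_span[of B] by simp
qed

lemma card_independent_le:
  assumes "independent B" shows "card B \<le> dim (UNIV :: 'v set)"
proof -
  obtain C where C: "B \<subseteq> C" "independent C" "span C = UNIV"
    using maximal_independent_subset_extend[OF subset_UNIV assms] by (metis top.extremum_uniqueI)
  then have "card C = dim (UNIV :: 'v set)" using basis_card_eq_dim[of C UNIV] by simp
  then show ?thesis using card_mono[OF finite_set C(1)] by simp
qed

lemma card_independent_lists:
  "card {xs. length xs = l \<and> distinct xs \<and> independent (set xs)}
     = (\<Prod>i<l. CARD('v) - CARD('k) ^ i)"
proof (induction l)
  case 0
  have "{xs::'v list. length xs = 0 \<and> distinct xs \<and> independent (set xs)} = {[]}"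
    by (auto simp: independent_empty)
  then show ?case by simp
next
  case (Suc l)
  let ?L = "\<lambda>l. {xs::'v list. length xs = l \<and> distinct xs \<and> independent (set xs)}"
  have fin: "finite (?L l)"
    by (rule finite_subset[OF _ finite_lists_length_eq[OF finite_UNIV, of l]]) auto
  have eq: "?L (Suc l) = (\<lambda>(xs, x). x # xs) ` (SIGMA xs:?L l. - span (set xs))"
  proof (intro set_eqI iffI)
    fix ys assume ys: "ys \<in> ?L (Suc l)"
    then obtain x xs where "ys = x # xs" by (cases ys) auto
    with ys show "ys \<in> (\<lambda>(xs, x). x # xs) ` (SIGMA xs:?L l. - span (set xs))"
      by (intro image_eqI[of _ _ "(xs, x)"]) (auto simp: independent_insert)
  next
    fix ys assume "ys \<in> (\<lambda>(xs, x). x # xs) ` (SIGMA xs:?L l. - span (set xs))"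
    then show "ys \<in> ?L (Suc l)" by (auto simp: independent_insertI intro: span_base)
  qed
  have "card (?L (Suc l)) = (\<Sum>xs\<in>?L l. card (- span (set xs)))"
    unfolding eq by (subst card_image) (auto simp: inj_on_def fin)
  also have "\<dots> = (\<Sum>xs\<in>?L l. CARD('v) - CARD('k) ^ l)"
    by (intro sum.cong) (auto simp: Compl_eq_Diff_UNIV card_Diff_subset finite_UNIV card_span distinct_card)
  finally show ?case using Suc.IH by simp
qed

end

lemma finite_span:
  fixes s :: "'k::{field,finite} \<Rightarrow> 'v::ab_group_add \<Rightarrow> 'v"
  assumes "vector_space s" and "finite B"
  shows "finite (module.span s B)"
proof -
  interpret vector_space s by (rule assms(1))
  show ?thesis using assms(2)
  proof (induction B rule: finite_induct)
    case (insert b B)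
    then show ?case unfolding span_insert_eq_image by simp
  qed simp
qed

lemma finite_vector_space_of_dimension:
  fixes s :: "'k::{field,finite} \<Rightarrow> 'v::ab_group_add \<Rightarrow> 'v"
  assumes "finite_dimensional_vector_space s B"
  shows "finite_vector_space s"
proof -
  interpret finite_dimensional_vector_space s B by (rule assms)
  show ?thesis
  proof
    show "finite (UNIV :: 'v set)"
      using finite_span[OF vector_space_axioms finite_Basis] by (simp add: span_Basis)
  qed
qed

section \<open>Linear maps with prescribed values\<close>

locale finite_vector_space_pair =
  V: finite_vector_space sV + W: finite_vector_space sW
  for sV :: "'k::{field,finite} \<Rightarrow> 'v::ab_group_add \<Rightarrow> 'v"
    and sW :: "'k \<Rightarrow> 'w::ab_group_add \<Rightarrow> 'w"
begin

sublocale vector_space_pair sV sW by unfold_locales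

lemma card_linear_extensions:
  assumes X: "V.independent X"
  shows "card {f. Vector_Spaces.linear sV sW f \<and> (\<forall>x\<in>X. f x = f0 x)}
    = CARD('w) ^ (V.dim (UNIV :: 'v set) - card X)"
proof -
  obtain C where C: "X \<subseteq> C" "V.independent C" "V.span C = UNIV"
    using V.maximal_independent_subset_extend[OF subset_UNIV X] by (metis top.extremum_uniqueI)
  have cC: "card C = V.dim (UNIV :: 'v set)" using V.basis_card_eq_dim[of C UNIV] C by simp
  let ?F = "{f. Vector_Spaces.linear sV sW f \<and> (\<forall>x\<in>X. f x = f0 x)}"
  have "bij_betw (\<lambda>f. restrict f (C - X)) ?F ((C - X) \<rightarrow>\<^sub>E UNIV)"
  proof (intro bij_betwI')
    fix f g assume f: "f \<in> ?F" and g: "g \<in> ?F"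
    show "restrict f (C - X) = restrict g (C - X) \<longleftrightarrow> f = g"
    proof
      assume eq: "restrict f (C - X) = restrict g (C - X)"
      have on_C: "f x = g x" if "x \<in> C" for x
        using f g fun_cong[OF eq, of x] that by (cases "x \<in> X") (simp_all add: restrict_def)
      show "f = g"
      proof
        fix x
        have "x \<in> V.span C" using C(3) by simp
        with f g show "f x = g x" by (intro linear_eq_on[of f g x C] on_C) simp_all
      qed
    qed simp
  next
    fix h assume h: "h \<in> (C - X) \<rightarrow>\<^sub>E (UNIV :: 'w set)"
    obtain f where f: "Vector_Spaces.linear sV sW f"
      "\<forall>x\<in>C. f x = (if x \<in> X then f0 x else h x)"
      using linear_independent_extend[OF C(2), of "\<lambda>x. if x \<in> X then f0 x else h x"] by (elim exE conjE)
    have "h = restrict f (C - X)"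
      using h f by (auto simp: fun_eq_iff PiE_def extensional_def)
    moreover have "f \<in> ?F" using f C(1) by auto
    ultimately show "\<exists>f\<in>?F. h = restrict f (C - X)" by blast
  qed auto
  then have "card ?F = card ((C - X) \<rightarrow>\<^sub>E (UNIV :: 'w set))" by (rule bij_betw_same_card)
  also have "\<dots> = CARD('w) ^ card (C - X)" by (simp add: card_PiE)
  also have "card (C - X) = card C - card X" using C(1) by (simp add: card_Diff_subset)
  finally show ?thesis by (simp add: cC)
qed

lemma finite_linear_maps: "finite {f. Vector_Spaces.linear sV sW f \<and> P f}"
proof -
  have "finite ((UNIV :: 'v set) \<rightarrow>\<^sub>E (UNIV :: 'w set))" by (intro finite_PiE) auto
  then have "finite (UNIV :: ('v \<Rightarrow> 'w) set)" by simp
  then show ?thesis by (rule rev_finite_subset) simp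
qed

end

section \<open>Orbits of nilpotent maps\<close>

context vector_space
begin

lemma linear_funpow: "Vector_Spaces.linear scale scale S \<Longrightarrow> Vector_Spaces.linear scale scale (S ^^ k)"
  by (induction k) (auto intro: Vector_Spaces.linear_compose simp: id_def[symmetric] linear_id)

text \<open>
  If one orbit vector is a combination of later ones modulo the invariant subspace \<open>A\<close>, then
  applying \<open>S\<close> shows the same for every later orbit vector. Since the orbit eventually
  vanishes, membership in \<open>A\<close> propagates backwards from its end.
\<close>

lemma nilpotent_orbit_step:
  assumes S: "Vector_Spaces.linear scale scale S" and A: "subspace A" and inv: "\<And>x. x \<in> A \<Longrightarrow> S x \<in> A"
    and nil: "(S ^^ k) w = 0"
    and mem: "(S ^^ i) w \<in> span (A \<union> {(S ^^ r) w |r. i < r})"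
  shows "(S ^^ i) w \<in> A"
proof -
  interpret S: Vector_Spaces.linear scale scale S by (rule S)
  have funpow_0_0: "(S ^^ n) 0 = 0" for n by (induction n) auto
  have step: "(S ^^ t) w \<in> span (A \<union> {(S ^^ r) w |r. t < r})" if "i \<le> t" for t
    using that
  proof (induction t rule: dec_induct)
    case base
    show ?case by (rule mem)
  next
    case (step t)
    have "(S ^^ Suc t) w \<in> S ` span (A \<union> {(S ^^ r) w |r. t < r})" using step.IH by simp
    also have "\<dots> = span (S ` (A \<union> {(S ^^ r) w |r. t < r}))" by (simp add: S.span_image)
    also have "\<dots> \<subseteq> span (A \<union> {(S ^^ r) w |r. Suc t < r})"
    proof (intro span_mono subsetI)
      fix y assume "y \<in> S ` (A \<union> {(S ^^ r) w |r. t < r})"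
      then consider x where "x \<in> A" "y = S x" | r where "t < r" "y = (S ^^ Suc r) w" by auto
      then show "y \<in> A \<union> {(S ^^ r) w |r. Suc t < r}"
        by cases (use inv in blast, use Suc_less_eq in blast)
    qed
    finally show ?case .
  qed
  have zero: "(S ^^ t) w = 0" if "k \<le> t" for t
  proof -
    have "(S ^^ t) w = (S ^^ (t - k)) ((S ^^ k) w)"
      using that by (metis funpow_add comp_apply le_add_diff_inverse2)
    also have "\<dots> = 0" unfolding nil by (rule funpow_0_0)
    finally show ?thesis .
  qed
  have "(S ^^ t) w \<in> A" if "i \<le> t" "k \<le> t + d" for d t
    using that
  proof (induction d arbitrary: t)
    case 0
    then show ?case using zero[of t] subspace_0[OF A] by simp
  next
    case (Suc d)
    have "A \<union> {(S ^^ r) w |r. t < r} \<subseteq> A"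
    proof -
      have "(S ^^ r) w \<in> A" if "t < r" for r
        using Suc.IH[of r] Suc.prems that by simp
      then show ?thesis by blast
    qed
    then have "span (A \<union> {(S ^^ r) w |r. t < r}) \<subseteq> A" using A by (simp add: span_minimal)
    then show ?case using step[OF Suc.prems(1)] by blast
  qed
  from this[of i k] show ?thesis by simp
qed

text \<open>
  Modulo an invariant subspace, the orbit of a vector under a nilpotent map is independent until
  it vanishes there. In a dependence of \<open>S\<^sup>j w\<close> on its predecessors, the earliest predecessor that
  really occurs can be exchanged with \<open>S\<^sup>j w\<close>; it then depends on later orbit vectors, hence lies
  in \<open>A\<close>, and so does \<open>S\<^sup>j w\<close>.
\<close>

lemma nilpotent_orbit_dependent:
  assumes S: "Vector_Spaces.linear scale scale S" and A: "subspace A" and inv: "\<And>x. x \<in> A \<Longrightarrow> S x \<in> A"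
    and nil: "(S ^^ k) w = 0"
    and mem: "(S ^^ j) w \<in> span (A \<union> (\<lambda>i. (S ^^ i) w) ` {..<j})"
  shows "(S ^^ j) w \<in> A"
proof -
  let ?s = "\<lambda>i. (S ^^ i) w"
  have up: "?s (i + d) \<in> A" if "?s i \<in> A" for i d
    using that by (induction d) (auto intro: inv)
  \<comment> \<open>The predecessors can be discarded one by one, starting with \<open>w\<close> itself.\<close>
  have "?s j \<in> span (A \<union> ?s ` {i..<j})" if "i \<le> j" for i
    using that
  proof (induction i)
    case 0
    show ?case using mem by (simp add: atLeast0LessThan)
  next
    case (Suc i)
    show ?case
    proof (rule ccontr)
      assume out: "?s j \<notin> span (A \<union> ?s ` {Suc i..<j})"
      have "{i..<j} = insert i {Suc i..<j}" using Suc.prems by auto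
      then have "A \<union> ?s ` {i..<j} = insert (?s i) (A \<union> ?s ` {Suc i..<j})" by auto
      then have "?s j \<in> span (insert (?s i) (A \<union> ?s ` {Suc i..<j}))" using Suc by simp
      from in_span_insert[OF this out]
      have "?s i \<in> span (insert (?s j) (A \<union> ?s ` {Suc i..<j}))" .
      moreover have "insert (?s j) (A \<union> ?s ` {Suc i..<j}) \<subseteq> A \<union> {?s r |r. i < r}"
        using Suc.prems by auto
      ultimately have "?s i \<in> span (A \<union> {?s r |r. i < r})" using span_mono by blast
      from nilpotent_orbit_step[OF S A inv nil this] have "?s i \<in> A" .
      from up[OF this, of "j - i"] have "?s j \<in> A" using Suc.prems by simp
      then show False using out by (auto intro: span_base)
    qed
  qed
  from this[of j] have "?s j \<in> span A" by simp
  then show ?thesis using A by (metis span_eq_iff)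
qed

end

definition nilpotent_on :: "('a::zero \<Rightarrow> 'a) \<Rightarrow> 'a set \<Rightarrow> bool" where
  "nilpotent_on S A \<longleftrightarrow> (\<forall>x\<in>A. S x \<in> A) \<and> (\<exists>k. \<forall>x\<in>A. (S ^^ k) x = 0)"

lemma nilpotent_on_cong:
  assumes "nilpotent_on S A" "\<And>x. x \<in> A \<Longrightarrow> S' x = S x"
  shows "nilpotent_on S' A"
proof -
  have inv: "S x \<in> A" if "x \<in> A" for x using assms(1) that by (simp add: nilpotent_on_def)
  have "(S' ^^ k) x = (S ^^ k) x \<and> (S ^^ k) x \<in> A" if "x \<in> A" for k x
    using that by (induction k) (simp_all add: inv assms(2))
  then show ?thesis using assms by (auto simp: nilpotent_on_def)
qed

lemma orbit_cong:
  assumes "\<And>i. i < j \<Longrightarrow> S' ((S ^^ i) w) = S ((S ^^ i) w)" and "i \<le> j"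
  shows "(S' ^^ i) w = (S ^^ i) w"
  using assms(2) by (induction i) (simp_all add: assms(1))

context vector_space
begin

text \<open>
  \<open>S\<^sup>m\<close> maps every vector of the orbit segment into \<open>span Y\<close>, so the exponent that kills
  \<open>span Y\<close> only has to be increased by \<open>m\<close>.
\<close>

lemma nilpotent_on_span_orbit:
  assumes S: "Vector_Spaces.linear scale scale S" and Y: "nilpotent_on S (span Y)"
    and ret: "(S ^^ m) w \<in> span Y"
  shows "nilpotent_on S (span (Y \<union> (\<lambda>i. (S ^^ i) w) ` {..<m}))"
proof -
  interpret S: Vector_Spaces.linear scale scale S by (rule S)
  let ?s = "\<lambda>i. (S ^^ i) w" and ?Z = "Y \<union> (\<lambda>i. (S ^^ i) w) ` {..<m}"
  have inv: "S x \<in> span Y" if "x \<in> span Y" for x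
    using Y that by (simp add: nilpotent_on_def)
  have inv_pow: "(S ^^ i) x \<in> span Y" if "x \<in> span Y" for x i
    using that by (induction i) (simp_all add: inv)
  obtain k where k: "\<And>x. x \<in> span Y \<Longrightarrow> (S ^^ k) x = 0"
    using Y by (auto simp: nilpotent_on_def)
  have YZ: "span Y \<subseteq> span ?Z" by (intro span_mono) simp
  have "S y \<in> span ?Z" if "y \<in> ?Z" for y
  proof -
    from that consider "y \<in> Y" | i where "i < m" "y = ?s i" by auto
    then show ?thesis
    proof cases
      case 1
      then show ?thesis using inv[of y] YZ span_base by blast
    next
      case 2
      show ?thesis
      proof (cases "Suc i = m")
        case True
        then show ?thesis using 2 ret YZ by auto
      next
        case False
        then have "S y \<in> ?s ` {..<m}" using 2 by (intro image_eqI[of _ _ "Suc i"]) auto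
        then show ?thesis by (simp add: span_base)
      qed
    qed
  qed
  then have "span ?Z \<subseteq> {x. S x \<in> span ?Z}"
    by (intro span_minimal S.subspace_linear_preimage) auto
  moreover have "(S ^^ (k + m)) y = 0" if y: "y \<in> ?Z" for y
  proof -
    have "(S ^^ m) y \<in> span Y"
    proof (cases "y \<in> Y")
      case True
      then show ?thesis by (simp add: inv_pow span_base)
    next
      case False
      then obtain i where "y = ?s i" using y by auto
      then have "(S ^^ m) y = (S ^^ i) ((S ^^ m) w)"
        by (metis add.commute funpow_add comp_apply)
      then show ?thesis using inv_pow[OF ret] by simp
    qed
    then show ?thesis by (simp add: funpow_add k)
  qed
  then have "span ?Z \<subseteq> {x. (S ^^ (k + m)) x = 0}"
    using linear_funpow[OF S, of "k + m"]
    by (intro span_minimal module_hom.subspace_kernel) (auto simp: module_hom_iff_linear)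
  ultimately show ?thesis unfolding nilpotent_on_def by blast
qed

lemma independent_chain:
  assumes "independent Y" and "finite Y"
    and "\<And>i. i < j \<Longrightarrow> s i \<notin> span (Y \<union> s ` {..<i})"
  shows "independent (Y \<union> s ` {..<j}) \<and> card (Y \<union> s ` {..<j}) = card Y + j"
  using assms(3)
proof (induction j)
  case 0
  then show ?case using assms(1) by simp
next
  case (Suc j)
  have eq: "Y \<union> s ` {..<Suc j} = insert (s j) (Y \<union> s ` {..<j})" by (auto simp: lessThan_Suc)
  have IH: "independent (Y \<union> s ` {..<j})" "card (Y \<union> s ` {..<j}) = card Y + j"
    using Suc.IH Suc.prems less_SucI by blast+
  have out: "s j \<notin> span (Y \<union> s ` {..<j})" using Suc.prems by blast
  then have "s j \<notin> Y \<union> s ` {..<j}" using span_base by metis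
  moreover have "finite (Y \<union> s ` {..<j})" using assms(2) by simp
  ultimately have "card (Y \<union> s ` {..<Suc j}) = card Y + Suc j"
    unfolding eq using IH(2) by (metis card_insert_disjoint add_Suc_right)
  moreover have "independent (Y \<union> s ` {..<Suc j})"
    unfolding eq by (rule independent_insertI[OF out IH(1)])
  ultimately show ?case by (rule conjI[rotated])
qed

end

context vector_space
begin

lemma chain_iff_independent_list:
  "(\<forall>i<l. s i \<notin> span (s ` {..<i})) \<longleftrightarrow>
     distinct (map s [0..<l]) \<and> independent (set (map s [0..<l]))"
proof -
  have set_eq: "set (map s [0..<l]) = s ` {..<l}" by (auto simp: atLeast0LessThan)
  show ?thesis
  proof
    assume "\<forall>i<l. s i \<notin> span (s ` {..<i})"
    then have "independent (s ` {..<l}) \<and> card (s ` {..<l}) = l"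
      using independent_chain[of "{}" l s] independent_empty by simp
    then have ind: "independent (s ` {..<l})" and "card (s ` {..<l}) = l" by blast+
    then have "card (set (map s [0..<l])) = length (map s [0..<l])" unfolding set_eq by simp
    then have "distinct (map s [0..<l])" by (rule card_distinct)
    then show "distinct (map s [0..<l]) \<and> independent (set (map s [0..<l]))"
      using ind unfolding set_eq by (rule conjI)
  next
    assume ind: "distinct (map s [0..<l]) \<and> independent (set (map s [0..<l]))"
    show "\<forall>i<l. s i \<notin> span (s ` {..<i})"
    proof (intro allI impI notI)
      fix i assume i: "i < l" "s i \<in> span (s ` {..<i})"
      have inj: "inj_on s {..<l}" using ind by (simp add: distinct_map atLeast0LessThan)
      have "s ` {..<i} \<subseteq> s ` {..<l} - {s i}"
        using i(1) inj by (auto simp: inj_on_def)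
      then have "s i \<in> span (s ` {..<l} - {s i})" using i(2) span_mono by blast
      then have "dependent (s ` {..<l})" using i(1) by (auto simp: dependent_def)
      then show False using ind unfolding set_eq by simp
    qed
  qed
qed

lemma dim_cyclic_span_chain:
  assumes S: "Vector_Spaces.linear scale scale S" and zero: "(S ^^ p) v = 0"
    and chain: "\<forall>i<p. (S ^^ i) v \<notin> span ((\<lambda>i. (S ^^ i) v) ` {..<i})"
  shows "dim (cyclic_span scale S v) = p"
proof -
  let ?s = "\<lambda>i. (S ^^ i) v"
  interpret S: Vector_Spaces.linear scale scale S by (rule S)
  have vanish: "?s (p + d) = 0" for d by (induction d) (simp_all add: zero)
  have "?s i \<in> span (?s ` {..<p})" for i
  proof (cases "i < p")
    case True
    then show ?thesis by (intro span_base) simp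
  next
    case False
    then show ?thesis using vanish[of "i - p"] by (simp add: span_zero)
  qed
  then have "range ?s \<subseteq> span (?s ` {..<p})" by blast
  moreover have "?s ` {..<p} \<subseteq> span (range ?s)" by (intro image_subsetI span_base rangeI)
  ultimately have "cyclic_span scale S v = span (?s ` {..<p})"
    unfolding cyclic_span_def span_eq by (rule conjI)
  moreover have "independent (?s ` {..<p}) \<and> card (?s ` {..<p}) = p"
    using independent_chain[of "{}" p ?s] independent_empty chain by simp
  ultimately show ?thesis using dim_span_eq_card_independent[of "?s ` {..<p}"] by simp
qed

text \<open>
  The first dependent orbit vector is zero by \<open>nilpotent_orbit_dependent\<close> with \<open>A = {0}\<close>, so
  the position of the first dependence and the position of the first zero both equal the
  dimension.
\<close>

lemma dim_cyclic_span_eq_iff: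
  assumes S: "Vector_Spaces.linear scale scale S" and nil: "(S ^^ k) v = 0"
  shows "dim (cyclic_span scale S v) = l \<longleftrightarrow> (S ^^ l) v = 0 \<and>
    distinct (map (\<lambda>i. (S ^^ i) v) [0..<l]) \<and> independent (set (map (\<lambda>i. (S ^^ i) v) [0..<l]))"
proof -
  let ?s = "\<lambda>i. (S ^^ i) v"
  define p where "p = (LEAST p. ?s p \<in> span (?s ` {..<p}))"
  have "?s k \<in> span (?s ` {..<k})" by (simp add: nil span_zero)
  then have p: "?s p \<in> span (?s ` {..<p})" unfolding p_def by (rule LeastI)
  have chain: "\<forall>i<p. ?s i \<notin> span (?s ` {..<i})"
    unfolding p_def by (intro allI impI not_less_Least)
  interpret S: Vector_Spaces.linear scale scale S by (rule S)
  have "?s p \<in> span ({0} \<union> ?s ` {..<p})" using p by simp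
  then have "?s p = 0"
    using nilpotent_orbit_dependent[OF S subspace_single_0 _ nil, of p] by simp
  from dim_cyclic_span_chain[OF S this chain]
  have dim: "dim (cyclic_span scale S v) = p" .
  show ?thesis unfolding chain_iff_independent_list[symmetric]
    using dim \<open>?s p = 0\<close> chain dim_cyclic_span_chain[OF S, of l v] by blast
qed

end

section \<open>Nilpotent completions for a fixed first map\<close>

context finite_vector_space_pair
begin

definition nilpotent_extensions :: "('v \<Rightarrow> 'w) \<Rightarrow> 'w set \<Rightarrow> ('w \<Rightarrow> 'v) \<Rightarrow> ('w \<Rightarrow> 'v) set" where
  "nilpotent_extensions f Y g0 =
     {g. Vector_Spaces.linear sW sV g \<and> (\<forall>y\<in>Y. g y = g0 y) \<and> nilpotent_map (f \<circ> g)}"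

lemma swap: "finite_vector_space_pair sW sV"
  by unfold_locales

lemma finite_nilpotent_extensions: "finite (nilpotent_extensions f Y g0)"
  unfolding nilpotent_extensions_def
  by (rule finite_vector_space_pair.finite_linear_maps[OF swap])

lemma agree_on_span:
  assumes "Vector_Spaces.linear sW sV g" "Vector_Spaces.linear sW sV h" "\<And>y. y \<in> Y \<Longrightarrow> g y = h y"
    and "y \<in> W.span Y"
  shows "g y = h y"
proof -
  interpret r: finite_vector_space_pair sW sV by (rule swap)
  show ?thesis using r.linear_eq_on[of g h y Y] assms by simp
qed

lemma linear_extend_by_value:
  assumes Y: "W.independent Y" "t \<notin> W.span Y"
  obtains g where "Vector_Spaces.linear sW sV g" "\<And>y. y \<in> Y \<Longrightarrow> g y = g0 y" "g t = u"
proof -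
  interpret r: finite_vector_space_pair sW sV by (rule swap)
  have ind: "W.independent (insert t Y)" using Y by (rule W.independent_insertI[rotated])
  then obtain g where g: "Vector_Spaces.linear sW sV g"
      "\<forall>y\<in>insert t Y. g y = (if y = t then u else g0 y)"
    using r.linear_independent_extend[OF ind, of "\<lambda>y. if y = t then u else g0 y"]
    by (elim exE conjE)
  have "t \<notin> Y" using Y(2) W.span_base by blast
  with g show ?thesis by (intro that[of g]) auto
qed

text \<open>
  The state of the exploration described at the beginning: \<open>g\<close> is known on \<open>Y\<close> and on the
  first \<open>j\<close> vectors of the orbit of \<open>w\<close>, and the tip, the \<open>j\<close>-th orbit vector, is still
  independent of these. The tip receives a value \<open>u\<close>, uniformly from \<open>V\<close>. Put
  \<open>D = f\<^sup>-\<^sup>1(span Y)\<close> and \<open>D' = f\<^sup>-\<^sup>1(span Z')\<close>, where \<open>Z'\<close> is \<open>Y\<close> together with the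
  orbit up to the tip, so that the next orbit vector \<open>f u\<close> lies in \<open>span Y\<close> or \<open>span Z'\<close>
  according as \<open>u\<close> lies in \<open>D\<close> or \<open>D'\<close>. With probability \<open>\<bar>D\<bar> / \<bar>V\<bar>\<close> the orbit returns to
  \<open>span Y\<close>, and then the proportion of nilpotent completions is \<open>\<bar>D'\<bar> / \<bar>V\<bar>\<close> by the formula
  for the larger set \<open>Z'\<close>, which is the assumption \<open>closed_case\<close>. With probability
  \<open>1 - \<bar>D'\<bar> / \<bar>V\<bar>\<close> the orbit grows, and the proportion is \<open>\<bar>D\<bar> / \<bar>V\<bar>\<close> by induction. In the
  remaining case no completion is nilpotent. The total is again \<open>\<bar>D\<bar> / \<bar>V\<bar>\<close>.
\<close>

lemma card_nilpotent_extensions_orbit: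
  fixes Y w n
  defines "n \<equiv> W.dim (UNIV :: 'w set)"
  assumes f: "Vector_Spaces.linear sV sW f"
    and Y: "W.independent Y"
    and closed_case: "\<And>Z h. W.independent Z \<Longrightarrow> card Y < card Z \<Longrightarrow>
        Vector_Spaces.linear sW sV h \<Longrightarrow> nilpotent_on (f \<circ> h) (W.span Z) \<Longrightarrow>
        card (nilpotent_extensions f Z h) * CARD('v)
          = CARD('v) ^ (n - card Z) * card (f -` W.span Z)"
  assumes g0: "Vector_Spaces.linear sW sV g0" "nilpotent_on (f \<circ> g0) (W.span Y)"
    and chain: "\<And>i. i \<le> j \<Longrightarrow>
        ((f \<circ> g0) ^^ i) w \<notin> W.span (Y \<union> (\<lambda>i. ((f \<circ> g0) ^^ i) w) ` {..<i})"
  shows "card (nilpotent_extensions f (Y \<union> (\<lambda>i. ((f \<circ> g0) ^^ i) w) ` {..<j}) g0) * CARD('v)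
      = CARD('v) ^ (n - card Y - j) * card (f -` W.span Y)"
  using g0 chain
proof (induction "n - card Y - j" arbitrary: g0 j rule: less_induct)
  case less
  define s where "s = (\<lambda>i. ((f \<circ> g0) ^^ i) w)"
  define Z where "Z = Y \<union> s ` {..<j}"
  define Z' where "Z' = Y \<union> s ` {..<Suc j}"
  define E where "E = nilpotent_extensions f Z g0"
  have chain: "s i \<notin> W.span (Y \<union> s ` {..<i})" if "i \<le> j" for i
    using less.prems(3)[OF that] by (simp add: s_def)
  have Z: "W.independent Z"
    using W.independent_chain[OF Y, of j s] chain by (simp add: Z_def)
  have Z': "W.independent Z'" "card Z' = card Y + Suc j"
    using W.independent_chain[OF Y, of "Suc j" s] chain by (simp_all add: Z'_def)
  have Z'_eq: "Z' = insert (s j) Z" by (auto simp: Z_def Z'_def lessThan_Suc)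
  have sj: "s j \<notin> W.span Z" using chain[of j] by (simp add: Z_def)
  have n: "card Y + Suc j \<le> n" using W.card_independent_le[OF Z'(1)] Z'(2) by (simp add: n_def)
  have "\<forall>u. \<exists>h. Vector_Spaces.linear sW sV h \<and> (\<forall>y\<in>Z. h y = g0 y) \<and> h (s j) = u"
    using linear_extend_by_value[OF Z sj] by metis
  then obtain h where h: "\<And>u. Vector_Spaces.linear sW sV (h u)"
      "\<And>u y. y \<in> Z \<Longrightarrow> h u y = g0 y" "\<And>u. h u (s j) = u"
    by metis
  \<comment> \<open>the number of nilpotent completions in which the tip receives the value \<open>u\<close>\<close>
  define C where "C = (\<lambda>u. card (nilpotent_extensions f Z' (h u)))"
  have orbit: "((f \<circ> g) ^^ i) w = s i" if "\<And>y. y \<in> Z \<Longrightarrow> g y = g0 y" "i \<le> j" for g i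
  proof -
    have "(f \<circ> g) (((f \<circ> g0) ^^ i) w) = (f \<circ> g0) (((f \<circ> g0) ^^ i) w)" if "i < j" for i
      using \<open>\<And>y. y \<in> Z \<Longrightarrow> g y = g0 y\<close> that by (simp add: Z_def s_def)
    from orbit_cong[of j "f \<circ> g" "f \<circ> g0" w, OF this that(2)] show ?thesis by (simp add: s_def)
  qed
  have orbit_Suc: "((f \<circ> g) ^^ Suc j) w = f (g (s j))" if "\<And>y. y \<in> Z \<Longrightarrow> g y = g0 y" for g
    using orbit[of g j] that by simp
  have nil_Y: "nilpotent_on (f \<circ> g) (W.span Y)"
    if "Vector_Spaces.linear sW sV g" "\<And>y. y \<in> Z \<Longrightarrow> g y = g0 y" for g
  proof (rule nilpotent_on_cong[OF less.prems(2)])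
    fix x assume "x \<in> W.span Y"
    then have "g x = g0 x"
      using agree_on_span[OF that(1) less.prems(1), of Y x] that(2) by (auto simp: Z_def)
    then show "(f \<circ> g) x = (f \<circ> g0) x" by simp
  qed
  have lin_fg: "Vector_Spaces.linear sW sW (f \<circ> g)" if "Vector_Spaces.linear sW sV g" for g
    using that f by (rule Vector_Spaces.linear_compose)

  have split: "card E = (\<Sum>u\<in>UNIV. C u)"
  proof -
    have "nilpotent_extensions f Z' (h u) = {g \<in> E. g (s j) = u}" for u
      using h(2,3) by (auto simp: E_def nilpotent_extensions_def Z'_eq)
    moreover have "E = (\<Union>u. {g \<in> E. g (s j) = u})" by auto
    moreover have "card (\<Union>u. {g \<in> E. g (s j) = u}) = (\<Sum>u\<in>UNIV. card {g \<in> E. g (s j) = u})"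
      by (rule card_UN_disjoint)
        (auto simp: V.finite_UNIV E_def intro: finite_subset[OF _ finite_nilpotent_extensions])
    ultimately show ?thesis by (simp add: C_def)
  qed
  \<comment> \<open>the number of all linear completions once the tip has its value\<close>
  define K where "K = CARD('v) ^ (n - card Y - Suc j)"
  define D D' where "D = f -` W.span Y" and "D' = f -` W.span Z'"
  have orbit_Z': "(\<lambda>i. ((f \<circ> h u) ^^ i) w) ` {..<Suc j} = s ` {..<Suc j}" for u
    using orbit[of "h u"] h(2) by (intro image_cong) auto
  have returns: "C u * CARD('v) = K * card D'" if "u \<in> D" for u
  proof -
    have "((f \<circ> h u) ^^ Suc j) w \<in> W.span Y"
      using that orbit_Suc[of "h u"] h by (simp add: D_def)
    then have "nilpotent_on (f \<circ> h u) (W.span Z')"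
      using W.nilpotent_on_span_orbit[OF lin_fg[OF h(1)[of u]] nil_Y[OF h(1)[of u]], of "Suc j" w]
        h(2) orbit_Z'[of u] by (simp add: Z'_def)
    from closed_case[OF Z'(1) _ h(1) this] show ?thesis
      by (simp add: C_def K_def D'_def Z'(2))
  qed
  have stuck: "C u = 0" if "u \<in> D' - D" for u
  proof -
    have "nilpotent_extensions f Z' (h u) = {}"
    proof (rule equals0I)
      fix g assume g: "g \<in> nilpotent_extensions f Z' (h u)"
      have lin: "Vector_Spaces.linear sW sV g" and agree: "\<And>y. y \<in> Z \<Longrightarrow> g y = g0 y"
        and gu: "g (s j) = u" and nil: "nilpotent_map (f \<circ> g)"
        using g h by (auto simp: nilpotent_extensions_def Z'_eq)
      have "(\<lambda>i. ((f \<circ> g) ^^ i) w) ` {..<Suc j} = s ` {..<Suc j}"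
        using orbit[of g] agree by (intro image_cong) auto
      then have "((f \<circ> g) ^^ Suc j) w \<in> W.span (Y \<union> (\<lambda>i. ((f \<circ> g) ^^ i) w) ` {..<Suc j})"
        using orbit_Suc[OF agree] that gu by (simp add: D'_def Z'_def)
      moreover have "\<dots> \<subseteq> W.span (W.span Y \<union> (\<lambda>i. ((f \<circ> g) ^^ i) w) ` {..<Suc j})"
        using W.span_superset by (intro W.span_mono) blast
      ultimately have mem: "((f \<circ> g) ^^ Suc j) w
          \<in> W.span (W.span Y \<union> (\<lambda>i. ((f \<circ> g) ^^ i) w) ` {..<Suc j})"
        by blast
      obtain k where "((f \<circ> g) ^^ k) w = 0" using nil by (auto simp: nilpotent_map_def)
      from W.nilpotent_orbit_dependent[OF lin_fg[OF lin] W.subspace_span _ this mem]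
      have "f u \<in> W.span Y"
        using nil_Y[OF lin agree] orbit_Suc[OF agree] gu by (simp add: nilpotent_on_def)
      then show False using that by (simp add: D_def)
    qed
    then show ?thesis by (simp add: C_def)
  qed
  have continues: "C u * CARD('v) = K * card D" if "u \<notin> D'" for u
  proof -
    have "((f \<circ> h u) ^^ i) w \<notin> W.span (Y \<union> (\<lambda>i. ((f \<circ> h u) ^^ i) w) ` {..<i})"
      if "i \<le> Suc j" for i
    proof (cases "i = Suc j")
      case True
      then show ?thesis using \<open>u \<notin> D'\<close> orbit_Suc[of "h u"] orbit_Z'[of u] h
        by (simp add: D'_def Z'_def)
    next
      case False
      then have i: "i \<le> j" using that by simp
      then have "(\<lambda>i. ((f \<circ> h u) ^^ i) w) ` {..<i} = s ` {..<i}"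
        using orbit[of "h u"] h(2) by (intro image_cong) auto
      then show ?thesis using chain[OF i] orbit[of "h u" i] h(2) i by simp
    qed
    moreover have "n - card Y - Suc j < n - card Y - j" using n by simp
    ultimately show ?thesis
      using less.hyps[OF _ h(1)[of u] nil_Y[OF h(1)[of u] h(2)], of "Suc j"]
      unfolding orbit_Z' by (simp add: C_def K_def D_def Z'_def)
  qed
  have DD': "D \<subseteq> D'" unfolding D_def D'_def Z'_def
    by (intro vimage_mono W.span_mono) simp
  have "card E * CARD('v) = (\<Sum>u\<in>UNIV. C u * CARD('v))" by (simp add: split sum_distrib_right)
  also have "\<dots> = (\<Sum>u\<in>UNIV. (if u \<in> D then K * card D' else 0) + (if u \<in> - D' then K * card D else 0))"
    using DD' by (intro sum.cong) (auto simp: returns stuck continues)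
  also have "\<dots> = card D * (K * card D') + card (- D') * (K * card D)"
    by (simp add: sum.distrib sum.If_cases V.finite_UNIV flip: Compl_eq)
  also have "\<dots> = K * (card D' + card (- D')) * card D" by (simp add: algebra_simps)
  also have "card D' + card (- D') = CARD('v)"
    using card_Un_disjoint[of D' "- D'"] by simp
  also have "K * CARD('v) = CARD('v) ^ (n - card Y - j)"
    using n unfolding K_def by (simp flip: power_Suc2 add: Suc_diff_Suc)
  finally show ?case by (simp add: E_def Z_def D_def s_def)
qed

text \<open>
  If \<open>span Y\<close> is not yet the whole space, an exploration starts at any vector \<open>w\<close> outside it,
  with no orbit value known.
\<close>

lemma card_nilpotent_extensions:
  fixes n
  defines "n \<equiv> W.dim (UNIV :: 'w set)"
  assumes f: "Vector_Spaces.linear sV sW f"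
  assumes "W.independent Y" "Vector_Spaces.linear sW sV g0" "nilpotent_on (f \<circ> g0) (W.span Y)"
  shows "card (nilpotent_extensions f Y g0) * CARD('v)
          = CARD('v) ^ (n - card Y) * card (f -` W.span Y)"
  using assms(3-)
proof (induction "n - card Y" arbitrary: Y g0 rule: less_induct)
  case less
  show ?case
  proof (cases "W.span Y = UNIV")
    case True
    have "nilpotent_extensions f Y g0 = {g. Vector_Spaces.linear sW sV g \<and> (\<forall>y\<in>Y. g y = g0 y)}"
    proof -
      have "nilpotent_map (f \<circ> g)" if "Vector_Spaces.linear sW sV g" "\<forall>y\<in>Y. g y = g0 y" for g
      proof -
        have "g = g0" using agree_on_span[OF that(1) less.prems(2), of Y] that(2) True by auto
        then show ?thesis using less.prems(3) True by (simp add: nilpotent_on_def nilpotent_map_def)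
      qed
      then show ?thesis by (auto simp: nilpotent_extensions_def)
    qed
    then show ?thesis
      using finite_vector_space_pair.card_linear_extensions[OF swap less.prems(1)] True
      by (simp add: n_def)
  next
    case False
    then obtain w where w: "w \<notin> W.span Y" by blast
    have closed_case: "card (nilpotent_extensions f Z h) * CARD('v)
          = CARD('v) ^ (n - card Z) * card (f -` W.span Z)"
      if "W.independent Z" "card Y < card Z" "Vector_Spaces.linear sW sV h"
        "nilpotent_on (f \<circ> h) (W.span Z)" for Z h
    proof (rule less.hyps[OF _ that(1,3,4)])
      show "n - card Z < n - card Y"
        using that(2) W.card_independent_le[OF that(1)] by (simp add: n_def)
    qed
    show ?thesis
      using card_nilpotent_extensions_orbit[OF f less.prems(1) closed_case[unfolded n_def]
          less.prems(2,3), of 0 w] w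
      by (simp add: n_def)
  qed
qed

end

section \<open>Nilpotent pairs along two given lists\<close>

lemma linear_map_0: "Vector_Spaces.linear s1 s2 f \<Longrightarrow> f 0 = 0"
  by (rule module_hom.zero[OF Vector_Spaces.linear.axioms(3)])

lemma ex_function_on_distinct_list:
  assumes "distinct xs"
  obtains h where "\<And>i. i < length xs \<Longrightarrow> h (xs ! i) = c i"
proof
  fix i assume "i < length xs"
  then show "c (inv_into {..<length xs} ((!) xs) (xs ! i)) = c i"
    using inj_on_nth[OF assms, of "{..<length xs}"] by (simp add: inv_into_f_f)
qed

lemma funpow_comp_swap: "((f \<circ> g) ^^ i) (f x) = f (((g \<circ> f) ^^ i) x)"
  by (induction i) simp_all

lemma nilpotent_map_swap:
  assumes "nilpotent_map (g \<circ> f)" and "f 0 = 0"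
  shows "nilpotent_map (f \<circ> g)"
proof -
  obtain k where k: "\<And>x. ((g \<circ> f) ^^ k) x = 0" using assms(1) by (auto simp: nilpotent_map_def)
  have "((f \<circ> g) ^^ Suc k) x = 0" for x
    unfolding funpow_Suc_right using funpow_comp_swap[of k f g "g x"] by (simp add: k assms(2))
  then show ?thesis unfolding nilpotent_map_def by blast
qed

context finite_vector_space_pair
begin

text \<open>
  The list \<open>vs\<close> is padded with \<open>0\<close>, the value of \<open>g\<close> at the last entry of \<open>ws\<close>. With this padding
  the chain starts at \<open>(vs @ [0]) ! 0\<close> also when \<open>vs\<close> is empty.
\<close>

definition pairs_along :: "'v list \<Rightarrow> 'w list \<Rightarrow> (('v \<Rightarrow> 'w) \<times> ('w \<Rightarrow> 'v)) set" where
  "pairs_along vs ws = {(f, g). nilpotent_pair sV sW f g \<and>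
     (\<forall>i<length vs. f (vs ! i) = ws ! i \<and> g (ws ! i) = (vs @ [0]) ! Suc i)}"

lemma pairs_along_orbit:
  assumes "\<forall>i<length vs. f (vs ! i) = ws ! i \<and> g (ws ! i) = (vs @ [0]) ! Suc i"
    and len: "length ws = length vs" and lin: "f 0 = 0" and i: "i \<le> length vs"
  shows "((g \<circ> f) ^^ i) ((vs @ [0]) ! 0) = (vs @ [0]) ! i"
    and "((f \<circ> g) ^^ i) ((ws @ [0]) ! 0) = (ws @ [0]) ! i"
    and "f ((vs @ [0]) ! i) = (ws @ [0]) ! i"
proof -
  have f: "f ((vs @ [0]) ! i) = (ws @ [0]) ! i" if "i \<le> length vs" for i
    using that assms(1) len lin by (simp add: nth_append)
  have g: "g ((ws @ [0]) ! i) = (vs @ [0]) ! Suc i" if "i < length vs" for i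
    using that assms(1) len by (simp add: nth_append)
  show "((g \<circ> f) ^^ i) ((vs @ [0]) ! 0) = (vs @ [0]) ! i"
    using i by (induction i) (simp_all add: f g)
  show "((f \<circ> g) ^^ i) ((ws @ [0]) ! 0) = (ws @ [0]) ! i"
    using i by (induction i) (simp_all add: f g)
  show "f ((vs @ [0]) ! i) = (ws @ [0]) ! i" by (rule f[OF i])
qed

text \<open>
  Double counting of the pairs \<open>(f, v)\<close> with \<open>f v \<in> span Y\<close>. For \<open>v \<in> span X\<close> the condition
  follows from the prescribed values; for any other \<open>v\<close> the value \<open>f v\<close> can be chosen freely
  in \<open>span Y\<close> and prescribed in addition.
\<close>

lemma sum_card_preimages:
  fixes m
  defines "m \<equiv> V.dim (UNIV :: 'v set)"
  assumes X: "V.independent X" and B: "\<And>x. x \<in> X \<Longrightarrow> f0 x \<in> W.span Y"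
    and Y: "W.independent Y"
  defines "F \<equiv> {f. Vector_Spaces.linear sV sW f \<and> (\<forall>x\<in>X. f x = f0 x)}"
  shows "(\<Sum>f\<in>F. card (f -` W.span Y)) = CARD('k) ^ card X * CARD('w) ^ (m - card X)
     + (CARD('v) - CARD('k) ^ card X) * (CARD('k) ^ card Y * CARD('w) ^ (m - Suc (card X)))"
proof -
  let ?B = "W.span Y"
  have finF: "finite F" unfolding F_def by (rule finite_linear_maps)
  have inside: "card {f \<in> F. f v \<in> ?B} = CARD('w) ^ (m - card X)" if v: "v \<in> V.span X" for v
  proof -
    have "f v \<in> ?B" if "f \<in> F" for f
    proof -
      interpret f: Vector_Spaces.linear sV sW f using that by (simp add: F_def)
      have "X \<subseteq> {x. f x \<in> ?B}" using that B by (auto simp: F_def)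
      then have "V.span X \<subseteq> {x. f x \<in> ?B}"
        by (intro V.span_minimal f.subspace_linear_preimage) auto
      then show ?thesis using v by blast
    qed
    then have "{f \<in> F. f v \<in> ?B} = F" by blast
    then show ?thesis using card_linear_extensions[OF X, of f0] by (simp add: F_def m_def)
  qed
  have outside: "card {f \<in> F. f v \<in> ?B} = CARD('k) ^ card Y * CARD('w) ^ (m - Suc (card X))"
    if v: "v \<notin> V.span X" for v
  proof -
    have vX: "v \<notin> X" using v V.span_base by metis
    have ext: "{f \<in> F. f v = u} = {f. Vector_Spaces.linear sV sW f \<and>
        (\<forall>x\<in>insert v X. f x = (f0(v := u)) x)}" for u
      using vX by (auto simp: F_def)
    have "card {f \<in> F. f v = u} = CARD('w) ^ (m - Suc (card X))" for u
      unfolding ext card_linear_extensions[OF V.independent_insertI[OF v X]] using vX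
      by (simp add: m_def)
    moreover have "{f \<in> F. f v \<in> ?B} = (\<Union>u\<in>?B. {f \<in> F. f v = u})" by blast
    moreover have "card (\<Union>u\<in>?B. {f \<in> F. f v = u}) = (\<Sum>u\<in>?B. card {f \<in> F. f v = u})"
      by (rule card_UN_disjoint) (auto simp: finF)
    ultimately show ?thesis by (simp add: W.card_span[OF Y])
  qed
  have "(\<Sum>f\<in>F. card (f -` ?B)) = (\<Sum>f\<in>F. \<Sum>v\<in>UNIV. if f v \<in> ?B then 1 else 0)"
    by (simp add: sum.If_cases V.finite_UNIV vimage_def)
  also have "\<dots> = (\<Sum>v\<in>UNIV. \<Sum>f\<in>F. if f v \<in> ?B then 1 else 0)" by (rule sum.swap)
  also have "\<dots> = (\<Sum>v\<in>UNIV. card {f \<in> F. f v \<in> ?B})"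
    using finF by (simp add: sum.If_cases Int_def)
  also have "\<dots> = (\<Sum>v\<in>UNIV. if v \<in> V.span X then CARD('w) ^ (m - card X)
      else CARD('k) ^ card Y * CARD('w) ^ (m - Suc (card X)))"
    by (intro sum.cong) (auto simp: inside outside)
  also have "\<dots> = card (V.span X) * CARD('w) ^ (m - card X)
      + card (- V.span X) * (CARD('k) ^ card Y * CARD('w) ^ (m - Suc (card X)))"
    by (simp add: sum.If_cases V.finite_UNIV flip: Compl_eq)
  also have "card (- V.span X) = CARD('v) - CARD('k) ^ card X"
    by (simp add: Compl_eq_Diff_UNIV card_Diff_subset V.finite_UNIV V.card_span[OF X])
  finally show ?thesis by (simp add: V.card_span[OF X])
qed

text \<open>
  For each \<open>f\<close> with the prescribed values, \<open>f \<circ> g\<close> moves every entry of \<open>ws\<close> to the next one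
  and the last one to \<open>0\<close>. So it is nilpotent on the span of \<open>ws\<close>, and
  \<open>card_nilpotent_extensions\<close> counts the maps \<open>g\<close>.
\<close>

lemma card_pairs_along:
  fixes m n
  defines "m \<equiv> V.dim (UNIV :: 'v set)" and "n \<equiv> W.dim (UNIV :: 'w set)"
  assumes vs: "length vs = l" "distinct vs" "V.independent (set vs)"
    and ws: "length ws = l" "distinct ws" "W.independent (set ws)"
  shows "card (pairs_along vs ws) * CARD('v) = CARD('v) ^ (n - l) *
     (CARD('k) ^ l * CARD('w) ^ (m - l)
       + (CARD('v) - CARD('k) ^ l) * (CARD('k) ^ l * CARD('w) ^ (m - Suc l)))"
proof -
  interpret r: finite_vector_space_pair sW sV by (rule swap)
  obtain f0 where f0: "\<And>i. i < l \<Longrightarrow> f0 (vs ! i) = ws ! i"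
    using ex_function_on_distinct_list[OF vs(2), of "(!) ws"] vs(1) by auto
  obtain h where h: "\<And>i. i < l \<Longrightarrow> h (ws ! i) = (vs @ [0]) ! Suc i"
    using ex_function_on_distinct_list[OF ws(2), of "\<lambda>i. (vs @ [0]) ! Suc i"] ws(1) by auto
  obtain g0 where g0: "Vector_Spaces.linear sW sV g0" "\<forall>y\<in>set ws. g0 y = h y"
    using r.linear_independent_extend[OF ws(3), of h] by (elim exE conjE)
  have g0_nth: "g0 (ws ! i) = (vs @ [0]) ! Suc i" if "i < l" for i
    using that g0(2) h ws(1) by simp
  define F where "F = {f. Vector_Spaces.linear sV sW f \<and> (\<forall>x\<in>set vs. f x = f0 x)}"
  have finF: "finite F" unfolding F_def by (rule finite_linear_maps)
  have F_nth: "f (vs ! i) = ws ! i" if "f \<in> F" "i < l" for f i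
    using that f0 vs(1) by (simp add: F_def)
  have F_iff: "f \<in> F \<longleftrightarrow> Vector_Spaces.linear sV sW f \<and> (\<forall>i<l. f (vs ! i) = ws ! i)" for f
    using f0 vs(1) by (simp add: F_def all_set_conv_all_nth)
  have zero: "f 0 = 0" if "Vector_Spaces.linear sV sW f" for f
    using that by (rule linear_map_0)
  have zero': "g 0 = 0" if "Vector_Spaces.linear sW sV g" for g
    using that by (rule linear_map_0)
  have "nilpotent_pair sV sW f g \<longleftrightarrow> Vector_Spaces.linear sV sW f \<and>
      Vector_Spaces.linear sW sV g \<and> nilpotent_map (f \<circ> g)" for f g
    unfolding nilpotent_pair_def using nilpotent_map_swap[of g f] nilpotent_map_swap[of f g] zero zero'
    by blast
  then have pairs: "pairs_along vs ws = (SIGMA f:F. nilpotent_extensions f (set ws) g0)"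
    unfolding pairs_along_def nilpotent_extensions_def
    using g0_nth ws(1) vs(1) by (auto simp: F_iff all_set_conv_all_nth)
  have count: "card (nilpotent_extensions f (set ws) g0) * CARD('v)
      = CARD('v) ^ (n - l) * card (f -` W.span (set ws))" if f: "f \<in> F" for f
  proof -
    have lin: "Vector_Spaces.linear sV sW f" using f by (simp add: F_def)
    have orbit: "((f \<circ> g0) ^^ i) ((ws @ [0]) ! 0) = (ws @ [0]) ! i" if "i \<le> l" for i
      using pairs_along_orbit(2)[of vs f ws g0 i] F_nth[OF f] g0_nth vs(1) ws(1) zero[OF lin] that
      by simp
    have lin_fg: "Vector_Spaces.linear sW sW (f \<circ> g0)"
      using g0(1) lin by (rule Vector_Spaces.linear_compose)
    have "nilpotent_on (f \<circ> g0) (W.span {})"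
      using zero[OF lin] zero'[OF g0(1)] by (auto simp: nilpotent_on_def intro: exI[of _ 0])
    moreover have "((f \<circ> g0) ^^ l) ((ws @ [0]) ! 0) \<in> W.span {}"
      using orbit[of l] ws(1) by (simp add: nth_append)
    moreover have "(\<lambda>i. ((f \<circ> g0) ^^ i) ((ws @ [0]) ! 0)) ` {..<l} = set ws"
    proof -
      have "(\<lambda>i. ((f \<circ> g0) ^^ i) ((ws @ [0]) ! 0)) ` {..<l} = (!) ws ` {..<l}"
        using orbit ws(1) by (intro image_cong) (auto simp: nth_append)
      then show ?thesis using ws(1) by (auto simp: set_conv_nth)
    qed
    ultimately have "nilpotent_on (f \<circ> g0) (W.span (set ws))"
      using W.nilpotent_on_span_orbit[OF lin_fg, of "{}" l "(ws @ [0]) ! 0"] by simp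
    from card_nilpotent_extensions[OF lin ws(3) g0(1) this]
    show ?thesis using distinct_card[OF ws(2)] ws(1) by (simp add: n_def)
  qed
  have "card (pairs_along vs ws) * CARD('v)
      = (\<Sum>f\<in>F. card (nilpotent_extensions f (set ws) g0) * CARD('v))"
    unfolding pairs by (simp add: finF finite_nilpotent_extensions sum_distrib_right)
  also have "\<dots> = CARD('v) ^ (n - l) * (\<Sum>f\<in>F. card (f -` W.span (set ws)))"
    by (simp add: count sum_distrib_left)
  also have "(\<Sum>f\<in>F. card (f -` W.span (set ws))) =
      CARD('k) ^ l * CARD('w) ^ (m - l)
       + (CARD('v) - CARD('k) ^ l) * (CARD('k) ^ l * CARD('w) ^ (m - Suc l))"
  proof -
    have "f0 x \<in> W.span (set ws)" if "x \<in> set vs" for x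
      using that f0 vs(1) ws(1) by (auto simp: in_set_conv_nth intro!: W.span_base)
    from sum_card_preimages[OF vs(3) this ws(3)]
    show ?thesis using distinct_card[OF ws(2)] distinct_card[OF vs(2)] vs(1) ws(1)
      by (simp add: F_def m_def)
  qed
  finally show ?thesis .
qed

text \<open>
  A balanced triple determines the lists of vectors \<open>T\<^sup>i v\<close> and \<open>f (T\<^sup>i v)\<close>, and conversely the
  starting vector can be read off from the lists.
\<close>

lemma card_balanced_triples:
  "card (balanced_triples sV sW l) =
    (\<Sum>(vs, ws) \<in> {vs. length vs = l \<and> distinct vs \<and> V.independent (set vs)}
        \<times> {ws. length ws = l \<and> distinct ws \<and> W.independent (set ws)}. card (pairs_along vs ws))"
proof -
  let ?LV = "{vs. length vs = l \<and> distinct vs \<and> V.independent (set vs)}"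
  let ?LW = "{ws. length ws = l \<and> distinct ws \<and> W.independent (set ws)}"
  let ?D = "SIGMA p:?LV \<times> ?LW. case_prod pairs_along p"
  let ?\<phi> = "\<lambda>((vs, ws :: 'w list), (f, g)). (f, g, (vs @ [0]) ! 0)"
  have triple_iff: "(f, g, v) \<in> balanced_triples sV sW l \<longleftrightarrow> nilpotent_pair sV sW f g \<and>
      ((g \<circ> f) ^^ l) v = 0 \<and> map (\<lambda>i. ((g \<circ> f) ^^ i) v) [0..<l] \<in> ?LV \<and>
      map (\<lambda>i. f (((g \<circ> f) ^^ i) v)) [0..<l] \<in> ?LW" for f g v
  proof (cases "nilpotent_pair sV sW f g")
    case True
    then have lin: "Vector_Spaces.linear sV sW f" "Vector_Spaces.linear sW sV g"
      and nil: "nilpotent_map (g \<circ> f)" by (simp_all add: nilpotent_pair_def)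
    have zero: "f 0 = 0" using lin(1) by (rule linear_map_0)
    obtain k where k: "((g \<circ> f) ^^ k) v = 0" using nil by (auto simp: nilpotent_map_def)
    have k': "((f \<circ> g) ^^ k) (f v) = 0" unfolding funpow_comp_swap by (simp only: k zero)
    have "V.dim (cyclic_span sV (g \<circ> f) v) = l \<longleftrightarrow> ((g \<circ> f) ^^ l) v = 0 \<and>
        map (\<lambda>i. ((g \<circ> f) ^^ i) v) [0..<l] \<in> ?LV"
      using V.dim_cyclic_span_eq_iff[OF Vector_Spaces.linear_compose[OF lin] k, of l] by simp
    moreover have "W.dim (cyclic_span sW (f \<circ> g) (f v)) = l \<longleftrightarrow> f (((g \<circ> f) ^^ l) v) = 0 \<and>
        map (\<lambda>i. f (((g \<circ> f) ^^ i) v)) [0..<l] \<in> ?LW"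
      using W.dim_cyclic_span_eq_iff[OF Vector_Spaces.linear_compose[OF lin(2,1)] k', of l]
      unfolding funpow_comp_swap by simp
    ultimately show ?thesis using True zero
      by (auto simp: balanced_triples_def balanced_def balanced_length_def)
  qed (simp add: balanced_triples_def)
  have recover: "((g \<circ> f) ^^ l) v = 0 \<and> vs = map (\<lambda>i. ((g \<circ> f) ^^ i) v) [0..<l] \<and>
      ws = map (\<lambda>i. f (((g \<circ> f) ^^ i) v)) [0..<l]"
    if L: "(vs, ws) \<in> ?LV \<times> ?LW" and P: "(f, g) \<in> pairs_along vs ws"
      and v: "v = (vs @ [0]) ! 0" for vs ws f g v
  proof -
    have len: "length vs = l" "length ws = l" using L by auto
    have "Vector_Spaces.linear sV sW f" using P by (simp add: pairs_along_def nilpotent_pair_def)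
    then have "f 0 = 0" by (rule linear_map_0)
    note orbit = pairs_along_orbit[of vs f ws g, OF _ _ this]
    have vs: "((g \<circ> f) ^^ i) v = (vs @ [0]) ! i" if "i \<le> l" for i
      using orbit(1)[of i] P that len v
      by (simp add: pairs_along_def)
    have ws: "f ((vs @ [0]) ! i) = (ws @ [0]) ! i" if "i \<le> l" for i
      using orbit(3)[of i] P that len
      by (simp add: pairs_along_def)
    have "((g \<circ> f) ^^ i) v = vs ! i" "f (((g \<circ> f) ^^ i) v) = ws ! i" if "i < l" for i
      using vs[of i] ws[of i] that len by (simp_all add: nth_append)
    then have "vs = map (\<lambda>i. ((g \<circ> f) ^^ i) v) [0..<l]"
      and "ws = map (\<lambda>i. f (((g \<circ> f) ^^ i) v)) [0..<l]"
      using len by (simp_all add: list_eq_iff_nth_eq)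
    then show ?thesis using vs[of l] len by (simp add: nth_append)
  qed
  have "bij_betw ?\<phi> ?D (balanced_triples sV sW l)"
    unfolding bij_betw_def
  proof
    show "inj_on ?\<phi> ?D"
    proof (rule inj_onI)
      fix x y assume x: "x \<in> ?D" and y: "y \<in> ?D" and eq: "?\<phi> x = ?\<phi> y"
      obtain vs ws f g where X: "x = ((vs, ws), (f, g))" by (metis prod.exhaust)
      obtain vs' ws' f' g' where Y: "y = ((vs', ws'), (f', g'))" by (metis prod.exhaust)
      have fg: "f' = f" "g' = g" "(vs' @ [0]) ! 0 = (vs @ [0]) ! 0" using eq by (simp_all add: X Y)
      have "vs = vs' \<and> ws = ws'"
        using recover[of vs ws f g "(vs @ [0]) ! 0"] recover[of vs' ws' f' g' "(vs @ [0]) ! 0"] x y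
        unfolding X Y fg by simp
      then show "x = y" by (simp add: X Y fg)
    qed
    show "?\<phi> ` ?D = balanced_triples sV sW l"
    proof (intro set_eqI iffI)
      fix t assume "t \<in> ?\<phi> ` ?D"
      then obtain vs ws f g where t: "t = (f, g, (vs @ [0]) ! 0)"
        and L: "(vs, ws) \<in> ?LV \<times> ?LW" and P: "(f, g) \<in> pairs_along vs ws" by auto
      show "t \<in> balanced_triples sV sW l"
        using recover[OF L P refl] L P unfolding t triple_iff by (auto simp: pairs_along_def)
    next
      fix t assume t: "t \<in> balanced_triples sV sW l"
      obtain f g v where T: "t = (f, g, v)" by (metis prod.exhaust)
      let ?vs = "map (\<lambda>i. ((g \<circ> f) ^^ i) v) [0..<l]" and ?ws = "map (\<lambda>i. f (((g \<circ> f) ^^ i) v)) [0..<l]"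
      have h: "nilpotent_pair sV sW f g" "((g \<circ> f) ^^ l) v = 0" "?vs \<in> ?LV" "?ws \<in> ?LW"
        using t unfolding T triple_iff by blast+
      have nth: "(?vs @ [0]) ! i = ((g \<circ> f) ^^ i) v" if "i \<le> l" for i
        using that h(2) by (cases "i = l") (simp_all add: nth_append)
      have "(f, g) \<in> pairs_along ?vs ?ws"
        using h(1) by (auto simp: pairs_along_def nth simp del: map_append)
      moreover have "v = (?vs @ [0]) ! 0" using nth[of 0] by simp
      ultimately show "t \<in> ?\<phi> ` ?D"
        unfolding T using h(3,4) by (intro image_eqI[of _ _ "((?vs, ?ws), (f, g))"]) auto
    qed
  qed
  then have "card (balanced_triples sV sW l) = card ?D" by (rule bij_betw_same_card[symmetric])
  also have "\<dots> = (\<Sum>p\<in>?LV \<times> ?LW. card (case_prod pairs_along p))"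
  proof (rule card_SigmaI)
    have "finite ?LV"
      by (rule finite_subset[OF _ finite_lists_length_eq[OF V.finite_UNIV, of l]]) auto
    moreover have "finite ?LW"
      by (rule finite_subset[OF _ finite_lists_length_eq[OF W.finite_UNIV, of l]]) auto
    ultimately show "finite (?LV \<times> ?LW)" by simp
    have "pairs_along vs ws \<subseteq> {f. Vector_Spaces.linear sV sW f \<and> True}
        \<times> {g. Vector_Spaces.linear sW sV g \<and> True}" for vs ws
      by (auto simp: pairs_along_def nilpotent_pair_def)
    then have "finite (pairs_along vs ws)" for vs ws
      by (rule finite_subset) (intro finite_cartesian_product finite_linear_maps
          finite_vector_space_pair.finite_linear_maps[OF swap])
    then show "\<forall>p\<in>?LV \<times> ?LW. finite (case_prod pairs_along p)" by auto
  qed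
  finally show ?thesis by (simp add: case_prod_unfold)
qed

end

section \<open>The number of balanced triples\<close>

text \<open>
  With \<open>m = l + a\<close> and \<open>n = l + b\<close>, the bracket in \<open>card_pairs_along\<close> becomes a power of \<open>Q\<close> times
  \<open>Q\<^sup>n + Q\<^sup>m - Q\<^sup>l\<close>, which is \<open>Q\<^sup>l (Q\<^sup>a + Q\<^sup>b - 1)\<close>.
\<close>

lemma power_factor_identity:
  fixes Q :: rat and l m n :: nat
  assumes Q: "Q \<noteq> 0" and l: "l \<le> m" "l \<le> n"
  shows "(Q ^ m) ^ (n - l) * (Q ^ l * (Q ^ n) ^ (m - l) + (Q ^ m - Q ^ l) * (Q ^ l * (Q ^ n) ^ (m - Suc l)))
    = Q ^ m * (Q powi (int l * (int m - int l)) * Q powi (int l * (int n - int l))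
      * Q powi (2 * (int m - int l) * (int n - int l) - (int m - int l) - (int n - int l))
      * (Q powi (int m - int l) + Q powi (int n - int l) - 1))" (is "?L = ?R")
proof -
  obtain a where a: "m = l + a" using l(1) le_Suc_ex by blast
  obtain b where b: "n = l + b" using l(2) le_Suc_ex by blast
  have powi: "Q powi (int m - int l) = Q ^ a" "Q powi (int n - int l) = Q ^ b"
    by (simp_all add: a b flip: power_int_of_nat)
  let ?e = "2 * (int m - int l) * (int n - int l) - (int m - int l) - (int n - int l)"
  have powi_add: "Q powi x * Q powi y = Q powi (x + y)" for x y
    using Q by (simp add: power_int_add)
  have "Q ^ m * (Q powi (int l * (int m - int l)) * Q powi (int l * (int n - int l)) * Q powi ?e)
    = Q powi (int m + (int l * (int m - int l) + int l * (int n - int l) + ?e))" (is "?M = _")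
    by (simp only: powi_add flip: power_int_of_nat)
  also have "int m + (int l * (int m - int l) + int l * (int n - int l) + ?e)
      = int l + int l * int a + int l * int b + 2 * int a * int b - int b"
    by (simp add: a b algebra_simps)
  finally have M: "?M = Q powi (int l + int l * int a + int l * int b + 2 * int a * int b - int b)" .
  have reduce: "?R = ?M * (Q ^ a + Q ^ b - 1)" unfolding powi by (simp only: mult.assoc)
  show ?thesis
    \<comment> \<open>For \<open>a = 0\<close> the truncated exponent \<open>m - Suc l\<close> is harmless: it comes with the factor \<open>Q\<^sup>m - Q\<^sup>l = 0\<close>.\<close>
  proof (cases a)
    case 0
    have "?M * Q ^ b = Q powi (int (l + l * b))"
      unfolding M unfolding power_int_of_nat[symmetric] powi_add by (simp add: 0)
    then have "?M * Q ^ b = Q ^ (l + l * b)" by (simp only: power_int_of_nat)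
    moreover have "?L = Q ^ (l + l * b)" by (simp add: 0 a b power_add power_mult)
    ultimately show ?thesis unfolding reduce by (simp add: 0)
  next
    case (Suc c)
    have "?M = Q powi (int (l + l * c + l + l * b + 2 * c * b + b))"
      unfolding M by (rule arg_cong[of _ _ "\<lambda>z. Q powi z"]) (simp add: Suc algebra_simps)
    then have M': "?M = Q ^ (l + l * c + l + l * b + 2 * c * b + b)" by (simp only: power_int_of_nat)
    have "?L = Q ^ (m * b + l + n * c) * (Q ^ n + Q ^ m - Q ^ l)"
      by (simp add: a b Suc power_add algebra_simps flip: power_mult)
    also have "Q ^ n + Q ^ m - Q ^ l = Q ^ l * (Q ^ a + Q ^ b - 1)"
      by (simp add: a b power_add algebra_simps)
    also have "Q ^ (m * b + l + n * c) * (Q ^ l * (Q ^ a + Q ^ b - 1))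
       = Q ^ (m * b + l + n * c + l) * (Q ^ a + Q ^ b - 1)"
      by (simp add: power_add)
    also have "m * b + l + n * c + l = l + l * c + l + l * b + 2 * c * b + b"
      by (simp add: a b Suc algebra_simps)
    finally show ?thesis unfolding reduce M' .
  qed
qed

text \<open>
  Truncated subtraction does no harm, because for \<open>l > m\<close> both products contain the zero factor
  with \<open>i = m\<close>.
\<close>

lemma of_nat_prod_diff_powers:
  fixes q :: nat assumes "0 < q"
  shows "(of_nat (\<Prod>i<l. q ^ m - q ^ i) :: rat) = (\<Prod>i<l. of_nat q ^ m - of_nat q ^ i)"
proof (cases "l \<le> m")
  case True
  then have "q ^ i \<le> q ^ m" if "i < l" for i using that assms by (intro power_increasing) auto
  then show ?thesis by (simp add: of_nat_diff)
next
  case False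
  then have "m \<in> {..<l}" by simp
  then have "(\<Prod>i<l. q ^ m - q ^ i) = 0" "(\<Prod>i<l. of_nat q ^ m - of_nat q ^ i :: rat) = 0"
    by (auto intro!: prod_zero bexI[of _ m])
  then show ?thesis by (simp only: of_nat_0)
qed

theorem theorem4p26:
  fixes sV :: "'k::{field,finite} \<Rightarrow> 'v::ab_group_add \<Rightarrow> 'v"
    and sW :: "'k \<Rightarrow> 'w::ab_group_add \<Rightarrow> 'w"
    and BV :: "'v set" and BW :: "'w set"
    and q m n l :: nat
  assumes "primepow q" and "CARD('k) = q"
    and "finite_dimensional_vector_space sV BV" and "vector_space.dim sV (UNIV :: 'v set) = m"
    and "finite_dimensional_vector_space sW BW" and "vector_space.dim sW (UNIV :: 'w set) = n"
  shows "(of_nat (card (balanced_triples sV sW l)) :: rat) =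
      (\<Prod>i<l. of_nat q ^ m - of_nat q ^ i) * (\<Prod>j<l. of_nat q ^ n - of_nat q ^ j)
      * of_nat q powi (int l * (int m - int l)) * of_nat q powi (int l * (int n - int l))
      * of_nat q powi (2 * (int m - int l) * (int n - int l) - (int m - int l) - (int n - int l))
      * (of_nat q powi (int m - int l) + of_nat q powi (int n - int l) - 1)"
proof -
  interpret V: finite_vector_space sV by (rule finite_vector_space_of_dimension[OF assms(3)])
  interpret W: finite_vector_space sW by (rule finite_vector_space_of_dimension[OF assms(5)])
  interpret finite_vector_space_pair sV sW by unfold_locales
  have q: "0 < q" using assms(1) by (rule primepow_gt_0_nat)
  have cV: "CARD('v) = q ^ m" using V.card_space assms(2,4) by simp
  have cW: "CARD('w) = q ^ n" using W.card_space assms(2,6) by simp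
  let ?LV = "{vs. length vs = l \<and> distinct vs \<and> V.independent (set vs)}"
  let ?LW = "{ws. length ws = l \<and> distinct ws \<and> W.independent (set ws)}"
  define PV PW where "PV = (\<Prod>i<l. q ^ m - q ^ i)" and "PW = (\<Prod>i<l. q ^ n - q ^ i)"
  define K where "K = (q ^ m) ^ (n - l) *
     (q ^ l * (q ^ n) ^ (m - l) + (q ^ m - q ^ l) * (q ^ l * (q ^ n) ^ (m - Suc l)))"
  have lists: "card ?LV = PV" "card ?LW = PW"
    using V.card_independent_lists[of l] W.card_independent_lists[of l]
    by (simp_all add: PV_def PW_def cV cW assms(2))
  have pairs: "card (pairs_along vs ws) * q ^ m = K" if "vs \<in> ?LV" "ws \<in> ?LW" for vs ws
    using card_pairs_along[of vs l ws] that by (simp add: K_def cV cW assms(2,4,6))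
  have "card (balanced_triples sV sW l) * q ^ m = (\<Sum>(vs, ws) \<in> ?LV \<times> ?LW. card (pairs_along vs ws) * q ^ m)"
    by (simp add: card_balanced_triples sum_distrib_right case_prod_unfold)
  also have "\<dots> = (\<Sum>(vs, ws) \<in> ?LV \<times> ?LW. K)"
    using pairs by (intro sum.cong) auto
  also have "\<dots> = PV * PW * K"
    by (simp add: case_prod_unfold card_cartesian_product lists)
  finally have count: "card (balanced_triples sV sW l) * q ^ m = PV * PW * K" .
  define Q where "Q = (of_nat q :: rat)"
  have Q: "Q \<noteq> 0" using q by (simp add: Q_def)
  let ?R = "Q powi (int l * (int m - int l)) * Q powi (int l * (int n - int l))
      * Q powi (2 * (int m - int l) * (int n - int l) - (int m - int l) - (int n - int l))
      * (Q powi (int m - int l) + Q powi (int n - int l) - 1)"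
  have rat_PV: "of_nat PV = (\<Prod>i<l. Q ^ m - Q ^ i)" and rat_PW: "of_nat PW = (\<Prod>i<l. Q ^ n - Q ^ i)"
    unfolding PV_def PW_def Q_def using of_nat_prod_diff_powers[OF q] by blast+
  \<comment> \<open>If \<open>l > m\<close> or \<open>l > n\<close>, both sides vanish because one of the products does.\<close>
  have "of_nat (card (balanced_triples sV sW l)) * Q ^ m = of_nat PV * of_nat PW * of_nat K"
    using arg_cong[OF count, of "of_nat :: nat \<Rightarrow> rat"] by (simp add: Q_def)
  also have "\<dots> = of_nat PV * of_nat PW * (Q ^ m * ?R)"
  proof (cases "l \<le> m \<and> l \<le> n")
    case True
    then have "q ^ l \<le> q ^ m" using q by (intro power_increasing) auto
    then have "of_nat K = (Q ^ m) ^ (n - l) * (Q ^ l * (Q ^ n) ^ (m - l)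
        + (Q ^ m - Q ^ l) * (Q ^ l * (Q ^ n) ^ (m - Suc l)))"
      by (simp add: K_def Q_def of_nat_diff)
    then show ?thesis using power_factor_identity[OF Q, of l m n] True by simp
  next
    case False
    have zero: "(\<Prod>i<l. q ^ r - q ^ i) = 0" if "r < l" for r
      using that by (auto intro!: prod_zero bexI[of _ r])
    have "PV = 0 \<or> PW = 0" unfolding PV_def PW_def using False zero[of m] zero[of n] by linarith
    then show ?thesis by auto
  qed
  finally have "of_nat (card (balanced_triples sV sW l)) * Q ^ m = (of_nat PV * of_nat PW * ?R) * Q ^ m"
    by (simp only: mult_ac)
  then have "of_nat (card (balanced_triples sV sW l)) = of_nat PV * of_nat PW * ?R"
    using Q by simp
  then show ?thesis unfolding rat_PV rat_PW Q_def by (simp only: mult.assoc)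
qed

end
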